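(* Let the ruled surfaces $\varphi_e$ and $\varphi_{e_1}$ form a Mannheim surface offset, with offset angle $\theta$. Then the conical curvature $\gamma_1$ of $\varphi_{e_1}$ is $$\gamma_1=\cot\theta.$$
   Context: Dual numbers: $D=\{a+\varepsilon a^*: a,a^*\in\mathbb{R}\}$ with $\varepsilon^2=0$. A differentiable real function $f$ extends to $D$ by $f(x+\varepsilon x^* )=f(x)+\varepsilon x^* f'(x)$; in particular this defines $\sin$, $\cos$. Dual vectors are $\tilde a=\vec a+\varepsilon\vec a^*$ with $\vec a,\vec a^*\in\mathbb{R}^3$; scalar and cross products are extended $D$-bilinearly. Ruled surface: all functions are smooth. $\varphi_e(s,v)=\vec c(s)+v\,\vec e(s)$, $s$ in an open interval, where $\langle\vec e,\vec e\rangle=1$, $s$ is the arc-length of the spherical curve $\vec e$, i.e. $\langle\vec e\,',\vec e\,'\rangle=1$, and $\vec c$ is the striction curve, i.e. $\langle\vec c\,',\vec e\,'\rangle=0$ (prime $=d/ds$). Put $\vec t=\vec e\,'$, $\vec g=\vec e\times\vec t$. The conical curvature $\gamma$ is defined by $\vec t\,'=\gamma\vec g-\vec e$ (so $\vec g\,'=-\gamma\vec t$). The ruled surface is represented by the dual unit vector $\tilde e=\vec e+\varepsilon\,\vec c\times\vec e$; its dual Darboux frame is $\{\tilde e,\tilde t,\tilde g\}$ with $\tilde t=\vec t+\varepsilon\,\vec c\times\vec t$, $\tilde g=\vec g+\varepsilon\,\vec c\times\vec g$. A second ruled surface $\varphi_{e_1}$ is given in the same way; the same symbols with index $1$ ($s_1,\vec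 c_1,\vec e_1,\vec t_1,\vec g_1,\gamma_1,\tilde e_1,\tilde t_1,\tilde g_1$) denote its corresponding objects, with derivatives taken with respect to $s_1$. Mannheim surface offset: $\varphi_e$ and $\varphi_{e_1}$ are Mannheim surface offsets if there is a one-to-one correspondence $s\mapsto s_1(s)$ between their rulings (smooth, with $ds_1/ds\neq0$) such that $\tilde g=\tilde t_1$ at corresponding parameters. Then the frames are related by $\tilde e_1=\cos\bar\theta\,\tilde e+\sin\bar\theta\,\tilde t$, $\tilde t_1=\tilde g$, $\tilde g_1=\sin\bar\theta\,\tilde e-\cos\bar\theta\,\tilde t$, where $\bar\theta=\theta+\varepsilon\theta^*$ (a smooth function of $s$, with $0\le\theta\le\pi$, $\theta^*\in\mathbb{R}$) is the dual angle between $\tilde e$ and $\tilde e_1$, called the dual offset angle; $\theta$ is the offset angle and $\theta^*$ the offset distance. *)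

theory Defs
  imports "HOL-Analysis.Analysis"
begin

unbundle cross3_syntax

section \<open>Dual numbers and dual vectors\<close>

text \<open>\<open>Dual a a'\<close> stands for \<open>a + \<epsilon> a'\<close> with \<open>\<epsilon>\<^sup>2 = 0\<close>. Dual numbers are of type
  \<open>real dual\<close>, dual vectors of type \<open>(real^3) dual\<close>.\<close>

datatype 'a dual = Dual (dual_re: 'a) (dual_im: 'a)

instantiation dual :: (plus) plus
begin
definition "x + y = Dual (dual_re x + dual_re y) (dual_im x + dual_im y)"
instance ..
end

instantiation dual :: (minus) minus
begin
definition "x - y = Dual (dual_re x - dual_re y) (dual_im x - dual_im y)"
instance ..
end

definition dual_scale :: "real dual \<Rightarrow> 'a::real_vector dual \<Rightarrow> 'a dual"  (infixr \<open>*\<^sub>D\<close> 75)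
  where "a *\<^sub>D v = Dual (dual_re a *\<^sub>R dual_re v)
                        (dual_re a *\<^sub>R dual_im v + dual_im a *\<^sub>R dual_re v)"

definition dual_extend :: "(real \<Rightarrow> real) \<Rightarrow> real dual \<Rightarrow> real dual"
  where "dual_extend f x = Dual (f (dual_re x)) (dual_im x * deriv f (dual_re x))"


section \<open>Ruled surfaces\<close>

text \<open>Infinitely differentiable; meant for open \<open>I\<close>. \<open>D n\<close> is the \<open>n\<close>-th derivative.\<close>

definition smooth_on :: "real set \<Rightarrow> (real \<Rightarrow> 'a::real_normed_vector) \<Rightarrow> bool"
  where "smooth_on I f \<longleftrightarrow> (\<exists>D :: nat \<Rightarrow> real \<Rightarrow> 'a. D 0 = f \<and>
           (\<forall>n. \<forall>s\<in>I. (D n has_vector_derivative D (Suc n) s) (at s)))"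

text \<open>The parameter of \<open>e\<close> is its arc length, and \<open>c\<close> is the striction curve.\<close>

definition ruled_surface ::
    "(real \<Rightarrow> real \<Rightarrow> real^3) \<Rightarrow> real set \<Rightarrow> (real \<Rightarrow> real^3) \<Rightarrow> (real \<Rightarrow> real^3) \<Rightarrow> bool"
  where "ruled_surface \<phi> I c e \<longleftrightarrow>
     open I \<and> is_interval I \<and> smooth_on I c \<and> smooth_on I e \<and>
     (\<forall>s\<in>I. (\<forall>v. \<phi> s v = c s + v *\<^sub>R e s) \<and>
        e s \<bullet> e s = 1 \<and>
        vector_derivative e (at s) \<bullet> vector_derivative e (at s) = 1 \<and>
        vector_derivative c (at s) \<bullet> vector_derivative e (at s) = 0)"

definition central_normal :: "(real \<Rightarrow> real^3) \<Rightarrow> real \<Rightarrow> real^3"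
  where "central_normal e s = vector_derivative e (at s)"

definition central_tangent :: "(real \<Rightarrow> real^3) \<Rightarrow> real \<Rightarrow> real^3"
  where "central_tangent e s = e s \<times> central_normal e s"

text \<open>The number \<open>\<gamma>\<close> with \<open>t' = \<gamma> g - e\<close>; it exists uniquely for every ruled surface
  (lemma \<open>conical_curvature\<close> below).\<close>

definition conical_curvature :: "(real \<Rightarrow> real^3) \<Rightarrow> real \<Rightarrow> real"
  where "conical_curvature e s =
    (THE \<gamma>. vector_derivative (central_normal e) (at s) = \<gamma> *\<^sub>R central_tangent e s - e s)"

definition dual_e :: "(real \<Rightarrow> real^3) \<Rightarrow> (real \<Rightarrow> real^3) \<Rightarrow> real \<Rightarrow> (real^3) dual"
  where "dual_e c e s = Dual (e s) (c s \<times> e s)"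

definition dual_t :: "(real \<Rightarrow> real^3) \<Rightarrow> (real \<Rightarrow> real^3) \<Rightarrow> real \<Rightarrow> (real^3) dual"
  where "dual_t c e s = Dual (central_normal e s) (c s \<times> central_normal e s)"

definition dual_g :: "(real \<Rightarrow> real^3) \<Rightarrow> (real \<Rightarrow> real^3) \<Rightarrow> real \<Rightarrow> (real^3) dual"
  where "dual_g c e s = Dual (central_tangent e s) (c s \<times> central_tangent e s)"


section \<open>Mannheim offsets\<close>

text \<open>\<open>\<sigma>\<close> is the correspondence \<open>s \<mapsto> s\<^sub>1(s)\<close> between the rulings.\<close>

definition mannheim_offset ::
    "real set \<Rightarrow> (real \<Rightarrow> real^3) \<Rightarrow> (real \<Rightarrow> real^3) \<Rightarrow>
     real set \<Rightarrow> (real \<Rightarrow> real^3) \<Rightarrow> (real \<Rightarrow> real^3) \<Rightarrow> (real \<Rightarrow> real) \<Rightarrow> bool"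
  where "mannheim_offset I c e I\<^sub>1 c\<^sub>1 e\<^sub>1 \<sigma> \<longleftrightarrow>
     bij_betw \<sigma> I I\<^sub>1 \<and> smooth_on I \<sigma> \<and>
     (\<forall>s\<in>I. deriv \<sigma> s \<noteq> 0 \<and> dual_g c e s = dual_t c\<^sub>1 e\<^sub>1 (\<sigma> s))"

text \<open>\<open>\<theta>\<close> and \<open>\<theta>'\<close> are the offset angle and the offset distance, i.e. \<open>\<theta> + \<epsilon> \<theta>'\<close> is the dual
  angle from \<open>e\<close> to \<open>e\<^sub>1\<close>, measured in the oriented dual plane of \<open>e\<close> and \<open>t\<close>. Together with
  \<open>t\<^sub>1 = g\<close> this determines the third frame vector (lemma \<open>mannheim_dual_g\<close> below).\<close>

definition dual_offset_angle ::
    "real set \<Rightarrow> (real \<Rightarrow> real^3) \<Rightarrow> (real \<Rightarrow> real^3) \<Rightarrow>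
     (real \<Rightarrow> real^3) \<Rightarrow> (real \<Rightarrow> real^3) \<Rightarrow> (real \<Rightarrow> real) \<Rightarrow>
     (real \<Rightarrow> real) \<Rightarrow> (real \<Rightarrow> real) \<Rightarrow> bool"
  where "dual_offset_angle I c e c\<^sub>1 e\<^sub>1 \<sigma> \<theta> \<theta>' \<longleftrightarrow>
     smooth_on I \<theta> \<and> smooth_on I \<theta>' \<and>
     (\<forall>s\<in>I. 0 \<le> \<theta> s \<and> \<theta> s \<le> pi \<and>
        dual_e c\<^sub>1 e\<^sub>1 (\<sigma> s) =
          dual_extend cos (Dual (\<theta> s) (\<theta>' s)) *\<^sub>D dual_e c e s +
          dual_extend sin (Dual (\<theta> s) (\<theta>' s)) *\<^sub>D dual_t c e s)"


section \<open>Consistency of the definitions\<close>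

lemma smooth_on_derivs:
  assumes "open I" "smooth_on I f" "s \<in> I"
  shows "(f has_vector_derivative vector_derivative f (at s)) (at s)"
    and "((\<lambda>u. vector_derivative f (at u)) has_vector_derivative
            vector_derivative (\<lambda>u. vector_derivative f (at u)) (at s)) (at s)"
proof -
  obtain D where D0: "D 0 = f"
    and D: "\<And>n u. u \<in> I \<Longrightarrow> (D n has_vector_derivative D (Suc n) u) (at u)"
    using assms(2) unfolding smooth_on_def by blast
  have f': "vector_derivative f (at u) = D 1 u" if "u \<in> I" for u
    using D[of u 0] that D0 by (simp add: vector_derivative_at)
  show "(f has_vector_derivative vector_derivative f (at s)) (at s)"
    using D[of s 0] assms(3) D0 f' by simp
  have "((\<lambda>u. vector_derivative f (at u)) has_vector_derivative D (Suc 1) s) (at s)"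
    by (rule has_vector_derivative_transform_within_open[OF D[of s 1]])
       (use assms f' in auto)
  then show "((\<lambda>u. vector_derivative f (at u)) has_vector_derivative
            vector_derivative (\<lambda>u. vector_derivative f (at u)) (at s)) (at s)"
    by (simp add: vector_derivative_at)
qed

lemma inner_const_derivs:
  fixes f g :: "real \<Rightarrow> real^3"
  assumes "open I" "s \<in> I" "\<And>u. u \<in> I \<Longrightarrow> f u \<bullet> g u = k"
    and "(f has_vector_derivative f') (at s)" "(g has_vector_derivative g') (at s)"
  shows "f s \<bullet> g' + f' \<bullet> g s = 0"
proof -
  have "((\<lambda>u. f u \<bullet> g u) has_vector_derivative (f s \<bullet> g' + f' \<bullet> g s)) (at s)"
    using bounded_bilinear.has_vector_derivative[OF bounded_bilinear_inner assms(4,5)] .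
  moreover have "((\<lambda>u. f u \<bullet> g u) has_vector_derivative 0) (at s)"
    by (rule has_vector_derivative_transform_within_open[of "\<lambda>_. k" _ _ I])
       (use assms in auto)
  ultimately show ?thesis
    using vector_derivative_unique_at by blast
qed

lemma orthonormal_expansion:
  fixes e t x :: "real^3"
  assumes "e \<bullet> e = 1" "t \<bullet> t = 1" "e \<bullet> t = 0"
  shows "x = (x \<bullet> e) *\<^sub>R e + (x \<bullet> t) *\<^sub>R t + (x \<bullet> (e \<times> t)) *\<^sub>R (e \<times> t)"
proof -
  let ?g = "e \<times> t"
  have gg: "?g \<bullet> ?g = 1"
    using assms by (simp add: dot_cross)
  have ge: "?g \<times> e = t" and gt: "?g \<times> t = - e"
    using assms cross_skew[of ?g e] cross_skew[of ?g t] Lagrange[of e e t] Lagrange[of t e t]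
    by (simp_all add: inner_commute)
  have "?g \<times> (?g \<times> x) = (?g \<bullet> x) *\<^sub>R ?g - x"
    using Lagrange[of ?g ?g x] gg by simp
  moreover have "?g \<times> x = (e \<bullet> x) *\<^sub>R t - (t \<bullet> x) *\<^sub>R e"
    using Lagrange[of x e t] cross_skew[of ?g x] by (simp add: inner_commute)
  then have "?g \<times> (?g \<times> x) = - (e \<bullet> x) *\<^sub>R e - (t \<bullet> x) *\<^sub>R t"
    by (simp add: Cross3.right_diff_distrib cross_mult_right ge gt)
  ultimately show ?thesis
    by (simp add: inner_commute algebra_simps)
qed

lemma ruled_surface_frame:
  assumes "ruled_surface \<phi> I c e" "s \<in> I"
  shows "e s \<bullet> e s = 1" "central_normal e s \<bullet> central_normal e s = 1"
    "e s \<bullet> central_normal e s = 0"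
proof -
  show "e s \<bullet> e s = 1" "central_normal e s \<bullet> central_normal e s = 1"
    using assms by (auto simp: ruled_surface_def central_normal_def)
  have d: "(e has_vector_derivative central_normal e s) (at s)"
    using assms smooth_on_derivs(1)[of I e s] by (auto simp: ruled_surface_def central_normal_def)
  have "e s \<bullet> central_normal e s + central_normal e s \<bullet> e s = 0"
    by (rule inner_const_derivs[OF _ assms(2) _ d d, of 1])
       (use assms in \<open>auto simp: ruled_surface_def\<close>)
  then show "e s \<bullet> central_normal e s = 0"
    by (simp add: inner_commute)
qed

lemma conical_curvature:
  assumes "ruled_surface \<phi> I c e" "s \<in> I"
  shows "(central_normal e has_vector_derivative
            conical_curvature e s *\<^sub>R central_tangent e s - e s) (at s)"
proof -
  let ?t = "central_normal e" and ?t' = "vector_derivative (central_normal e) (at s)"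
  let ?g = "central_tangent e s"
  note fr = ruled_surface_frame[OF assms(1)]
  have I: "open I" using assms by (simp add: ruled_surface_def)
  have t_eq: "?t = (\<lambda>u. vector_derivative e (at u))"
    by (auto simp: central_normal_def)
  have de: "(e has_vector_derivative ?t s) (at s)"
    using assms smooth_on_derivs(1)[of I e s] by (auto simp: ruled_surface_def central_normal_def)
  have dt: "(?t has_vector_derivative ?t') (at s)"
    using assms smooth_on_derivs(2)[of I e s] by (auto simp: ruled_surface_def t_eq)
  have "?t s \<bullet> ?t' + ?t' \<bullet> ?t s = 0"
    by (rule inner_const_derivs[OF I assms(2) fr(2) dt dt])
  moreover have "e s \<bullet> ?t' + ?t s \<bullet> ?t s = 0"
    by (rule inner_const_derivs[OF I assms(2) fr(3) de dt])
  ultimately have "?t' \<bullet> ?t s = 0" "?t' \<bullet> e s = - 1"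
    using fr(2)[OF assms(2)] by (simp_all add: inner_commute)
  then have ex: "?t' = (?t' \<bullet> ?g) *\<^sub>R ?g - e s"
    using orthonormal_expansion[OF fr[OF assms(2)], of ?t'] by (simp add: central_tangent_def)
  have "?g \<bullet> ?g = 1"
    using fr[OF assms(2)] by (simp add: central_tangent_def dot_cross)
  then have "?g \<noteq> 0"
    by auto
  then have "conical_curvature e s = ?t' \<bullet> ?g"
    unfolding conical_curvature_def
    by (intro the_equality[where P = "\<lambda>\<gamma>. ?t' = \<gamma> *\<^sub>R ?g - e s", OF ex])
       (metis ex diff_add_cancel scaleR_cancel_right)
  then show ?thesis
    using dt ex by simp
qed

lemma mannheim_dual_g:
  assumes "ruled_surface \<phi> I c e" "ruled_surface \<phi>\<^sub>1 I\<^sub>1 c\<^sub>1 e\<^sub>1"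
    and "mannheim_offset I c e I\<^sub>1 c\<^sub>1 e\<^sub>1 \<sigma>" "dual_offset_angle I c e c\<^sub>1 e\<^sub>1 \<sigma> \<theta> \<theta>'" "s \<in> I"
  shows "dual_g c\<^sub>1 e\<^sub>1 (\<sigma> s) =
           dual_extend sin (Dual (\<theta> s) (\<theta>' s)) *\<^sub>D dual_e c e s -
           dual_extend cos (Dual (\<theta> s) (\<theta>' s)) *\<^sub>D dual_t c e s"
proof -
  define E T G C where "E = e s" and "T = central_normal e s" and "G = E \<times> T" and "C = c s"
  define E1 T1 C1 where "E1 = e\<^sub>1 (\<sigma> s)" and "T1 = central_normal e\<^sub>1 (\<sigma> s)" and "C1 = c\<^sub>1 (\<sigma> s)"
  note fr = ruled_surface_frame[OF assms(1,5), folded E_def T_def]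
  have [simp]: "E \<times> G = - T" "T \<times> G = E"
    using fr Lagrange[of E E T] Lagrange[of T E T] by (simp_all add: G_def inner_commute)
  have [simp]: "deriv sin x = cos x" "deriv cos x = - sin x" for x :: real
    by (auto intro!: DERIV_imp_deriv derivative_eq_intros)
  have T1: "T1 = G" "C1 \<times> T1 = C \<times> G"
    using assms(3,5) unfolding mannheim_offset_def dual_g_def dual_t_def central_tangent_def
    by (auto simp: G_def E_def T_def C_def C1_def T1_def)
  have E1: "E1 = cos (\<theta> s) *\<^sub>R E + sin (\<theta> s) *\<^sub>R T"
      "C1 \<times> E1 = cos (\<theta> s) *\<^sub>R (C \<times> E) - (\<theta>' s * sin (\<theta> s)) *\<^sub>R E
               + (sin (\<theta> s) *\<^sub>R (C \<times> T) + (\<theta>' s * cos (\<theta> s)) *\<^sub>R T)"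
    using assms(4,5) unfolding dual_offset_angle_def
    by (auto simp: dual_e_def dual_t_def dual_scale_def dual_extend_def plus_dual_def
        E_def T_def C_def C1_def E1_def)
  have leib: "a \<times> (x \<times> y) = (a \<times> x) \<times> y + x \<times> (a \<times> y)" for a x y :: "real^3"
    by (simp add: cross3_simps)
  have G1: "E1 \<times> G = sin (\<theta> s) *\<^sub>R E - cos (\<theta> s) *\<^sub>R T"
    by (simp add: E1(1) cross_add_left cross_mult_left)
  have "C1 \<times> (E1 \<times> T1) = (C1 \<times> E1) \<times> G + E1 \<times> (C \<times> G)"
    using leib[of C1 E1 T1] T1 by simp
  also have "\<dots> = cos (\<theta> s) *\<^sub>R (C \<times> (E \<times> G)) + sin (\<theta> s) *\<^sub>R (C \<times> (T \<times> G))
      - (\<theta>' s * sin (\<theta> s)) *\<^sub>R (E \<times> G) + (\<theta>' s * cos (\<theta> s)) *\<^sub>R (T \<times> G)"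
    unfolding E1(2) leib[of C E G] leib[of C T G]
    by (simp add: E1(1) cross_add_left cross_mult_left Cross3.left_diff_distrib scaleR_add_right)
  also have "\<dots> = sin (\<theta> s) *\<^sub>R (C \<times> E) + (\<theta>' s * cos (\<theta> s)) *\<^sub>R E
      - (cos (\<theta> s) *\<^sub>R (C \<times> T) + - (\<theta>' s * sin (\<theta> s)) *\<^sub>R T)"
    by simp
  finally show ?thesis
    using G1 T1(1)
    by (simp add: dual_g_def dual_e_def dual_t_def dual_scale_def dual_extend_def minus_dual_def
        central_tangent_def E_def T_def C_def C1_def E1_def T1_def)
qed

end

theory Submission
  imports Defs
begin

text \<open>
  The central tangent \<open>g\<close> of the first surface is the central normal \<open>t\<^sub>1\<close> of the second, so it
  is orthogonal both to \<open>e\<close> and to \<open>e' = t\<close>. Differentiating \<open>\<langle>t\<^sub>1 \<circ> \<sigma>, e\<rangle> = 0\<close> therefore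
  leaves only the term in which \<open>t\<^sub>1\<close> is differentiated. By the Darboux equation
  \<open>t\<^sub>1' = \<gamma>\<^sub>1 g\<^sub>1 - e\<^sub>1\<close> this term is \<open>\<sigma>' \<langle>\<gamma>\<^sub>1 g\<^sub>1 - e\<^sub>1, e\<rangle>\<close>, and since
  \<open>e\<^sub>1 = cos \<theta> e + sin \<theta> t\<close> and \<open>g\<^sub>1 = sin \<theta> e - cos \<theta> t\<close>, it equals
  \<open>\<sigma>' (\<gamma>\<^sub>1 sin \<theta> - cos \<theta>)\<close>. As \<open>\<sigma>'\<close> does not vanish, \<open>\<gamma>\<^sub>1 sin \<theta> = cos \<theta>\<close>. This
  relation also excludes \<open>sin \<theta> = 0\<close>, because sine and cosine have no common zero.
\<close>

lemma smooth_on_has_field_derivative: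
  fixes f :: "real \<Rightarrow> real"
  assumes "smooth_on I f" "s \<in> I"
  shows "(f has_field_derivative deriv f s) (at s)"
proof -
  obtain d where "(f has_vector_derivative d) (at s)"
    using assms unfolding smooth_on_def by metis
  then have "(f has_field_derivative d) (at s)"
    by (simp add: has_real_derivative_iff_has_vector_derivative)
  then show ?thesis
    using DERIV_imp_deriv by blast
qed

text \<open>Real parts of the dual frame equations: they turn the correspondence of dual frames into
  a rotation of the frames of the two spherical images, where the Darboux equations apply.\<close>

lemma mannheim_real_frame:
  assumes "ruled_surface \<phi> I c e" "ruled_surface \<phi>\<^sub>1 I\<^sub>1 c\<^sub>1 e\<^sub>1"
    and "mannheim_offset I c e I\<^sub>1 c\<^sub>1 e\<^sub>1 \<sigma>" "dual_offset_angle I c e c\<^sub>1 e\<^sub>1 \<sigma> \<theta> \<theta>'" "s \<in> I"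
  shows "e\<^sub>1 (\<sigma> s) = cos (\<theta> s) *\<^sub>R e s + sin (\<theta> s) *\<^sub>R central_normal e s"
    and "central_normal e\<^sub>1 (\<sigma> s) = central_tangent e s"
    and "central_tangent e\<^sub>1 (\<sigma> s) = sin (\<theta> s) *\<^sub>R e s - cos (\<theta> s) *\<^sub>R central_normal e s"
proof -
  show "e\<^sub>1 (\<sigma> s) = cos (\<theta> s) *\<^sub>R e s + sin (\<theta> s) *\<^sub>R central_normal e s"
    using assms(4,5)
    by (auto simp: dual_offset_angle_def dual_e_def dual_t_def dual_scale_def dual_extend_def
        plus_dual_def)
  show "central_normal e\<^sub>1 (\<sigma> s) = central_tangent e s"
    using assms(3,5) by (auto simp: mannheim_offset_def dual_g_def dual_t_def)
  show "central_tangent e\<^sub>1 (\<sigma> s) = sin (\<theta> s) *\<^sub>R e s - cos (\<theta> s) *\<^sub>R central_normal e s"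
    using mannheim_dual_g[OF assms]
    by (simp add: dual_e_def dual_t_def dual_g_def dual_scale_def dual_extend_def minus_dual_def)
qed

text \<open>This is the \<open>e\<close>-component of the derivative of \<open>t\<^sub>1 = g\<close>. The form without division
  holds before \<open>sin \<theta> \<noteq> 0\<close> is known and is what yields it.\<close>

lemma mannheim_conical_curvature_sin:
  assumes "ruled_surface \<phi> I c e" "ruled_surface \<phi>\<^sub>1 I\<^sub>1 c\<^sub>1 e\<^sub>1"
    and "mannheim_offset I c e I\<^sub>1 c\<^sub>1 e\<^sub>1 \<sigma>" "dual_offset_angle I c e c\<^sub>1 e\<^sub>1 \<sigma> \<theta> \<theta>'" "s \<in> I"
  shows "conical_curvature e\<^sub>1 (\<sigma> s) * sin (\<theta> s) = cos (\<theta> s)"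
proof -
  let ?t1' = "conical_curvature e\<^sub>1 (\<sigma> s) *\<^sub>R central_tangent e\<^sub>1 (\<sigma> s) - e\<^sub>1 (\<sigma> s)"
  note fr = ruled_surface_frame[OF assms(1,5)]
  note off = mannheim_real_frame[OF assms(1-4)]
  have I: "open I" "smooth_on I e"
    using assms(1) by (auto simp: ruled_surface_def)
  have \<sigma>: "smooth_on I \<sigma>" "deriv \<sigma> s \<noteq> 0" "\<sigma> s \<in> I\<^sub>1"
    using assms(3,5) by (auto simp: mannheim_offset_def bij_betw_def)
  have de: "(e has_vector_derivative central_normal e s) (at s)"
    using smooth_on_derivs(1)[OF I assms(5)] by (simp add: central_normal_def)
  have dt1: "((\<lambda>u. central_normal e\<^sub>1 (\<sigma> u)) has_vector_derivative deriv \<sigma> s *\<^sub>R ?t1') (at s)"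
    using vector_diff_chain_at[OF
        smooth_on_has_field_derivative[OF \<sigma>(1) assms(5),
          unfolded has_real_derivative_iff_has_vector_derivative] conical_curvature[OF assms(2) \<sigma>(3)]]
    by (simp add: o_def)
  have "central_normal e\<^sub>1 (\<sigma> s) \<bullet> central_normal e s + (deriv \<sigma> s *\<^sub>R ?t1') \<bullet> e s = 0"
    by (rule inner_const_derivs[OF I(1) assms(5) _ dt1 de, of 0])
       (simp add: off(2) central_tangent_def dot_cross_self)
  moreover have "central_normal e\<^sub>1 (\<sigma> s) \<bullet> central_normal e s = 0"
    by (simp add: off(2)[OF assms(5)] central_tangent_def dot_cross_self)
  ultimately have "?t1' \<bullet> e s = 0"
    using \<sigma>(2) by simp
  moreover have "?t1' \<bullet> e s = conical_curvature e\<^sub>1 (\<sigma> s) * sin (\<theta> s) - cos (\<theta> s)"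
    using fr by (simp add: off(1,3)[OF assms(5)] inner_diff_left inner_add_left
        inner_commute[of "central_normal e s" "e s"])
  ultimately show ?thesis
    by simp
qed

theorem theorem3p5:
  fixes \<phi> \<phi>\<^sub>1 :: "real \<Rightarrow> real \<Rightarrow> real^3"
    and I I\<^sub>1 :: "real set"
    and c e c\<^sub>1 e\<^sub>1 :: "real \<Rightarrow> real^3"
    and \<sigma> \<theta> \<theta>' :: "real \<Rightarrow> real"
  assumes "ruled_surface \<phi> I c e"
    and "ruled_surface \<phi>\<^sub>1 I\<^sub>1 c\<^sub>1 e\<^sub>1"
    and "mannheim_offset I c e I\<^sub>1 c\<^sub>1 e\<^sub>1 \<sigma>"
    and "dual_offset_angle I c e c\<^sub>1 e\<^sub>1 \<sigma> \<theta> \<theta>'"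
  shows "\<forall>s\<in>I. sin (\<theta> s) \<noteq> 0 \<and> conical_curvature e\<^sub>1 (\<sigma> s) = cot (\<theta> s)"
proof (intro ballI conjI)
  fix s assume s: "s \<in> I"
  note rel = mannheim_conical_curvature_sin[OF assms s]
  show nz: "sin (\<theta> s) \<noteq> 0"
    using rel sin_zero_norm_cos_one[of "\<theta> s"] by auto
  show "conical_curvature e\<^sub>1 (\<sigma> s) = cot (\<theta> s)"
    using rel nz by (simp add: cot_def field_simps)
qed

end
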